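(* Let $(A_k)_k$ be a dyadic hierarchy of rate $\gamma>0$ and prefactor $c>0$ for $f=\nabla\mathcal{L}$, i.e. $\|A_k-f\|_\infty\le 2^{-k}$ and $\mathrm{Cost}(A_k)\le c^\gamma 2^{\gamma k}$ for every $k$. Fix $\delta=2^{-k_{\max}}$ and $\sigma>0$, and let $$\tilde f_{\delta,\sigma}=\sum_{k=k_{\min}}^{k_{\max}}\frac{B_k}{p_k}\,(A_k-A_{k-1}),\qquad p_k=\min\Big\{C\,2^{-(1+\frac{\gamma}{2})k},\,1\Big\},$$ with $B_k\sim\mathrm{Bernoulli}(p_k)$ independent, drawn at each call. Then the bias of $\tilde f_{\delta,\sigma}$ is at most $\delta$ whatever the $p_k$, and $C>0$ may be chosen so that its variance is at most $\sigma^2$, at expected compute $$\mathbb{E}\big[\mathrm{Cost}(\tilde f_{\delta,\sigma})\big]\ \asymp\ \begin{cases} c^\gamma\,\delta^{2-\gamma}\,\sigma^{-2}, & \gamma>2,\\ c^2\,\sigma^{-2}\log^2\frac{\sigma}{\delta}, & \gamma=2,\\ (c/\sigma)^\gamma, & \gamma<2,\end{cases}$$ up to a factor depending only on $\gamma$. Moreover no other choice of the probabilities $p_k\in(0,1]$ does better, i.e. achieves variance at most $\sigma^2$ at an expected compute of smaller order.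
   Context: $\mathcal{L}:\mathbb{R}^d\to\mathbb{R}$ is convex and $\beta$-smooth, with gradient $f=\nabla\mathcal{L}$. $\|\cdot\|_\infty$ denotes $\sup_y\|\cdot(y)\|$ with the Euclidean norm. $A_k$ (indexed by integers $k$) are deterministic algorithms computing maps $\mathbb{R}^d\to\mathbb{R}^d$, and $\mathrm{Cost}(A_k)$ is the compute of one evaluation. Coarsest level: $k_{\min}$ is the integer such that $k_{\min}-1=\lfloor-\log_2 c\rfloor$. The algorithm $A_{k_{\min}-1}$ then has compute at most $1$ and is taken to be the constant function $0$. The bias of $\tilde f_{\delta,\sigma}$ at $y$ is $\|\mathbb{E}[\tilde f_{\delta,\sigma}(y)]-f(y)\|$, and its variance is $\mathbb{E}\|\tilde f_{\delta,\sigma}(y)-\mathbb{E}\tilde f_{\delta,\sigma}(y)\|^2$. The compute of a call is the sum, over the levels $k$ with $B_k=1$, of the compute of drawing the increment $A_k-A_{k-1}$ (evaluating $A_k$ and $A_{k-1}$). When $p_k=1$ for all levels up to some $k_\ast$, the telescoping sum over those levels is a single evaluation of $A_{k_\ast}$. Variance and compute are budgeted through the guaranteed bounds of the hierarchy: squared increments $V_k=\|A_k-A_{k-1}\|_\infty^2\le 9\cdot 4^{-k}$ and increment costs $C_k\le 2c^\gamma2^{\gamma k}$. $\asymp$ and optimality are understood at the level of these budgets.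
   Formalization: The displayed rate fails for some σ: as a lower bound on compute it is proved only for σ ≥ δ and, if γ ≤ 2, σ ≤ c; as an upper bound, for γ = 2, only outside δ/2 < σ < 2δ (at σ = δ the log vanishes). k_min ≤ k_max is assumed. *)

theory Defs
  imports "HOL-Probability.Probability"
begin

(* Extended-real valued, so that an unbounded function has norm infinity. *)
definition sup_norm :: "('b \<Rightarrow> 'a::real_normed_vector) \<Rightarrow> ereal" where
  "sup_norm g = (SUP y. ereal (norm (g y)))"

(* cost k is the compute of one evaluation of the map A k. *)
definition dyadic_hierarchy ::
    "real \<Rightarrow> real \<Rightarrow> ('a::real_normed_vector \<Rightarrow> 'a) \<Rightarrow> (int \<Rightarrow> 'a \<Rightarrow> 'a) \<Rightarrow> (int \<Rightarrow> real) \<Rightarrow> bool" where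
  "dyadic_hierarchy \<gamma> c f A cost \<longleftrightarrow>
     (\<forall>k. sup_norm (\<lambda>y. A k y - f y) \<le> ereal (2 powi (- k))) \<and>
     (\<forall>k. 0 \<le> cost k \<and> cost k \<le> c powr \<gamma> * 2 powr (\<gamma> * of_int k))"

definition k_min :: "real \<Rightarrow> int" where
  "k_min c = \<lfloor>- log 2 c\<rfloor> + 1"

definition level_prob :: "real \<Rightarrow> real \<Rightarrow> int \<Rightarrow> real" where
  "level_prob \<gamma> C k = min (C * 2 powr (- (1 + \<gamma> / 2) * of_int k)) 1"

definition prob_choice :: "(int \<Rightarrow> real) \<Rightarrow> int \<Rightarrow> int \<Rightarrow> bool" where
  "prob_choice p lo hi \<longleftrightarrow> (\<forall>k\<in>{lo..hi}. 0 < p k \<and> p k \<le> 1)"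

(* Joint law of the independent Bernoulli variables at the levels lo..hi;
   outside this range the value is the dummy False. *)
definition switches :: "(int \<Rightarrow> real) \<Rightarrow> int \<Rightarrow> int \<Rightarrow> (int \<Rightarrow> bool) pmf" where
  "switches p lo hi = Pi_pmf {lo..hi} False (\<lambda>k. bernoulli_pmf (p k))"

definition estimator ::
    "(int \<Rightarrow> 'a \<Rightarrow> 'a::real_vector) \<Rightarrow> (int \<Rightarrow> real) \<Rightarrow> int \<Rightarrow> int \<Rightarrow> (int \<Rightarrow> bool) \<Rightarrow> 'a \<Rightarrow> 'a" where
  "estimator A p lo hi B y = (\<Sum>k=lo..hi. (of_bool (B k) / p k) *\<^sub>R (A k y - A (k - 1) y))"

definition est_mean ::
    "(int \<Rightarrow> 'a \<Rightarrow> 'a::euclidean_space) \<Rightarrow> (int \<Rightarrow> real) \<Rightarrow> int \<Rightarrow> int \<Rightarrow> 'a \<Rightarrow> 'a" where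
  "est_mean A p lo hi y =
     measure_pmf.expectation (switches p lo hi) (\<lambda>B. estimator A p lo hi B y)"

definition est_bias ::
    "('a \<Rightarrow> 'a) \<Rightarrow> (int \<Rightarrow> 'a \<Rightarrow> 'a::euclidean_space) \<Rightarrow> (int \<Rightarrow> real) \<Rightarrow> int \<Rightarrow> int \<Rightarrow> 'a \<Rightarrow> real" where
  "est_bias f A p lo hi y = norm (est_mean A p lo hi y - f y)"

definition est_variance ::
    "(int \<Rightarrow> 'a \<Rightarrow> 'a::euclidean_space) \<Rightarrow> (int \<Rightarrow> real) \<Rightarrow> int \<Rightarrow> int \<Rightarrow> 'a \<Rightarrow> real" where
  "est_variance A p lo hi y =
     measure_pmf.expectation (switches p lo hi)
       (\<lambda>B. (norm (estimator A p lo hi B y - est_mean A p lo hi y))\<^sup>2)"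

(* The largest level up to which all probabilities equal 1; it is lo - 1 if p lo is not 1. *)
definition sat_level :: "(int \<Rightarrow> real) \<Rightarrow> int \<Rightarrow> int \<Rightarrow> int" where
  "sat_level p lo hi = Max {k \<in> {lo - 1..hi}. \<forall>j\<in>{lo..k}. p j = 1}"

(* The increments up to sat_level are always drawn and telescope to one evaluation of
   A (sat_level p lo hi), using A (lo - 1) = 0. Every other drawn increment costs an
   evaluation of A k and one of A (k - 1). *)
definition call_compute ::
    "(int \<Rightarrow> real) \<Rightarrow> (int \<Rightarrow> real) \<Rightarrow> int \<Rightarrow> int \<Rightarrow> (int \<Rightarrow> bool) \<Rightarrow> real" where
  "call_compute cost p lo hi B =
     (let s = sat_level p lo hi in
      (if lo \<le> s then cost s else 0) +
      (\<Sum>k=s+1..hi. of_bool (B k) * (cost k + cost (k - 1))))"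

definition expected_compute :: "(int \<Rightarrow> real) \<Rightarrow> (int \<Rightarrow> real) \<Rightarrow> int \<Rightarrow> int \<Rightarrow> real" where
  "expected_compute cost p lo hi =
     measure_pmf.expectation (switches p lo hi) (call_compute cost p lo hi)"

(* 9 * 4^-k bounds the squared sup norm of A k - A (k - 1), because
   (2^-k + 2^-(k-1))^2 = 9 * 4^-k; the variance of B k / p k is 1 / p k - 1. *)
definition variance_budget :: "(int \<Rightarrow> real) \<Rightarrow> int \<Rightarrow> int \<Rightarrow> real" where
  "variance_budget p lo hi = (\<Sum>k=lo..hi. (1 / p k - 1) * (9 * 4 powi (- k)))"

(* Expectation of call_compute with each evaluation of A k replaced by its guaranteed bound
   and each increment by twice the bound at its upper level. *)
definition compute_budget :: "real \<Rightarrow> real \<Rightarrow> (int \<Rightarrow> real) \<Rightarrow> int \<Rightarrow> int \<Rightarrow> real" where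
  "compute_budget \<gamma> c p lo hi =
     (let s = sat_level p lo hi in
      (if lo \<le> s then c powr \<gamma> * 2 powr (\<gamma> * of_int s) else 0) +
      (\<Sum>k=s+1..hi. p k * (2 * c powr \<gamma> * 2 powr (\<gamma> * of_int k))))"

definition compute_rate :: "real \<Rightarrow> real \<Rightarrow> real \<Rightarrow> real \<Rightarrow> real" where
  "compute_rate \<gamma> c \<delta> \<sigma> =
     (if \<gamma> > 2 then c powr \<gamma> * \<delta> powr (2 - \<gamma>) / \<sigma>\<^sup>2
      else if \<gamma> = 2 then c\<^sup>2 / \<sigma>\<^sup>2 * (ln (\<sigma> / \<delta>))\<^sup>2
      else (c / \<sigma>) powr \<gamma>)"

end

theory Submission
  imports Defs
begin

text \<open>
  Independence makes the mean of the estimator the telescoping sum of all increments, hence the finest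
  level, whose distance to \<open>f\<close> is at most \<open>\<delta>\<close>; and it makes the variance the sum of the variances of
  the levels, which the hierarchy bounds by the variance budget.

  The choice of probabilities is an allocation problem: minimise the cost \<open>\<Sum> q\<^sub>k w\<^sub>k\<close> with
  \<open>w\<^sub>k = 2 c\<^sup>\<gamma> 2\<^sup>\<gamma>\<^sup>k\<close>, subject to \<open>\<Sum> (1 / q\<^sub>k - 1) v\<^sub>k \<le> \<sigma>\<^sup>2\<close> with \<open>v\<^sub>k = 9 \<cdot> 4\<^sup>-\<^sup>k\<close>. Charging every
  saturated increment separately, instead of a single evaluation for all of them, changes the cost only
  by a constant factor, because the costs grow geometrically (\<open>compute_budget_le_linear_budget\<close>).
  For this linear cost the Lagrangian separates over the levels, and its minimiser on \<open>(0, 1]\<close> is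
  \<open>min (C sqrt (v\<^sub>k / w\<^sub>k)) 1\<close> up to the normalisation of \<open>C\<close>, which is the prescribed form. If \<open>C\<close>
  is chosen by continuity so that the variance constraint is an equality (\<open>exists_exact_variance\<close>), the
  prescribed probabilities are therefore exactly optimal for the linear cost (\<open>level_prob_optimal\<close>),
  and optimal up to a factor depending on \<open>\<gamma>\<close> for the compute budget.

  With optimality at hand, the rates need no analysis of the optimal \<open>C\<close>. The upper bound follows from
  any feasible competitor of the right cost (\<open>truncated_sampling\<close>, \<open>achievable_rate\<close>), and the lower
  bound from the Cauchy--Schwarz inequality between the cost and the variance, valid for all feasible
  probabilities (\<open>linear_budget_lower_bound\<close>, \<open>necessary_rate\<close>). Both are governed by sums of
  \<open>sqrt (v\<^sub>k w\<^sub>k)\<close>, proportional to \<open>2\<^sup>(\<^sup>\<gamma>\<^sup>/\<^sup>2\<^sup>-\<^sup>1\<^sup>)\<^sup>k\<close>: they are dominated by the finest level for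
  \<open>\<gamma> > 2\<close>, by the coarsest unsaturated level for \<open>\<gamma> < 2\<close>, and by the number of levels for \<open>\<gamma> = 2\<close>.
\<close>

section \<open>Moments of the estimator\<close>

lemma finite_set_switches: "finite (set_pmf (switches p lo hi))"
  unfolding switches_def
  by (rule finite_subset[OF set_Pi_pmf_subset'])
     (auto intro: finite_subset[OF subset_UNIV])

lemma integrable_switches:
  fixes g :: "(int \<Rightarrow> bool) \<Rightarrow> 'a::{banach, second_countable_topology}"
  shows "integrable (measure_pmf (switches p lo hi)) g"
  by (rule integrable_measure_pmf_finite[OF finite_set_switches])

text \<open>
  Stated for sets of levels so that one application of independence yields the first moments (one
  level) and the mixed second moments (two levels) of the switches.
\<close>
lemma expectation_switches_prod:
  assumes "prob_choice p lo hi" and "J \<subseteq> {lo..hi}"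
  shows "measure_pmf.expectation (switches p lo hi) (\<lambda>B. \<Prod>k\<in>J. of_bool (B k)) = (\<Prod>k\<in>J. p k)"
proof -
  let ?f = "\<lambda>k b. if k \<in> J then of_bool b else (1::real)"
  have restrict: "(\<Prod>k\<in>J. g k) = (\<Prod>k\<in>{lo..hi}. if k \<in> J then g k else 1)" for g :: "int \<Rightarrow> real"
    using assms(2) by (simp add: prod.If_cases Int_absorb1)
  have "measure_pmf.expectation (switches p lo hi) (\<lambda>B. \<Prod>k\<in>J. of_bool (B k))
      = measure_pmf.expectation (switches p lo hi) (\<lambda>B. \<Prod>k\<in>{lo..hi}. ?f k (B k))"
    by (subst restrict) simp
  also have "\<dots> = (\<Prod>k\<in>{lo..hi}. measure_pmf.expectation (bernoulli_pmf (p k)) (?f k))"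
    unfolding switches_def
    by (rule expectation_prod_Pi_pmf)
       (auto intro!: integrable_measure_pmf_finite intro: finite_subset[OF subset_UNIV])
  also have "\<dots> = (\<Prod>k\<in>{lo..hi}. if k \<in> J then p k else 1)"
    using assms(1) by (intro prod.cong) (auto simp: prob_choice_def less_imp_le)
  finally show ?thesis by (simp only: restrict)
qed

lemma expectation_switch:
  assumes "prob_choice p lo hi" and "k \<in> {lo..hi}"
  shows "measure_pmf.expectation (switches p lo hi) (\<lambda>B. of_bool (B k)) = p k"
  using expectation_switches_prod[OF assms(1), of "{k}"] assms(2) by simp

lemma covariance_switches:
  assumes "prob_choice p lo hi" and "j \<in> {lo..hi}" and "k \<in> {lo..hi}"
  shows "measure_pmf.expectation (switches p lo hi)
           (\<lambda>B. (of_bool (B j) / p j - 1) * (of_bool (B k) / p k - 1)) = (if j = k then 1 / p k - 1 else 0)"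
proof -
  let ?E = "\<lambda>g. measure_pmf.expectation (switches p lo hi) g :: real"
  have pos: "p j > 0" "p k > 0" using assms by (auto simp: prob_choice_def)
  have prod: "?E (\<lambda>B. of_bool (B j) * of_bool (B k)) = (if j = k then p k else p j * p k)"
  proof (cases "j = k")
    case True
    then show ?thesis using expectation_switch[OF assms(1,3)]
      by (simp flip: of_bool_conj)
  next
    case False
    then show ?thesis using expectation_switches_prod[OF assms(1), of "{j, k}"] assms(2,3) by simp
  qed
  have "?E (\<lambda>B. (of_bool (B j) / p j - 1) * (of_bool (B k) / p k - 1))
      = ?E (\<lambda>B. (of_bool (B j) * of_bool (B k)) / (p j * p k) - of_bool (B j) / p j - of_bool (B k) / p k + 1)"
    by (intro Bochner_Integration.integral_cong refl) (simp add: algebra_simps)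
  also have "\<dots> = ?E (\<lambda>B. of_bool (B j) * of_bool (B k)) / (p j * p k)
      - ?E (\<lambda>B. of_bool (B j)) / p j - ?E (\<lambda>B. of_bool (B k)) / p k + 1"
    by (simp add: integrable_switches)
  also have "\<dots> = (if j = k then 1 / p k - 1 else 0)"
    using pos by (simp add: prod expectation_switch[OF assms(1,2)] expectation_switch[OF assms(1,3)] field_simps)
  finally show ?thesis .
qed

text \<open>
  Dividing by \<open>p k\<close> cancels the mean of the switch, so the mean does not depend on the probabilities.
\<close>
lemma est_mean_eq:
  fixes A :: "int \<Rightarrow> 'a \<Rightarrow> 'a::euclidean_space"
  assumes "prob_choice p lo hi"
  shows "est_mean A p lo hi y = (\<Sum>k=lo..hi. A k y - A (k - 1) y)"
proof -
  have "est_mean A p lo hi y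
      = (\<Sum>k=lo..hi. (measure_pmf.expectation (switches p lo hi) (\<lambda>B. of_bool (B k)) / p k)
                        *\<^sub>R (A k y - A (k - 1) y))"
    unfolding est_mean_def estimator_def
    by (simp add: Bochner_Integration.integral_sum integrable_switches)
  also have "\<dots> = (\<Sum>k=lo..hi. A k y - A (k - 1) y)"
  proof (intro sum.cong refl)
    fix k assume k: "k \<in> {lo..hi}"
    then have "p k > 0" using assms by (simp add: prob_choice_def)
    then show "(measure_pmf.expectation (switches p lo hi) (\<lambda>B. of_bool (B k)) / p k)
        *\<^sub>R (A k y - A (k - 1) y) = A k y - A (k - 1) y"
      by (simp add: expectation_switch[OF assms k])
  qed
  finally show ?thesis .
qed

lemma est_mean_telescope:
  fixes A :: "int \<Rightarrow> 'a \<Rightarrow> 'a::euclidean_space"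
  assumes "prob_choice p lo hi" and "lo - 1 \<le> hi"
  shows "est_mean A p lo hi y = A hi y - A (lo - 1) y"
proof -
  have "(\<Sum>k=lo..hi. A k y - A (k - 1) y) = A hi y - A (lo - 1) y"
    using assms(2)
  proof (induction hi rule: int_ge_induct)
    case (step i)
    have "{lo..i + 1} = insert (i + 1) {lo..i}" using step.hyps by auto
    then show ?case using step.IH by simp
  qed simp
  then show ?thesis by (simp add: est_mean_eq[OF assms(1)])
qed

text \<open>
  Expanding the squared norm gives inner products of increments weighted by the covariances of the
  normalised switches; independence removes every pair of distinct levels.
\<close>
lemma est_variance_eq:
  fixes A :: "int \<Rightarrow> 'a \<Rightarrow> 'a::euclidean_space"
  assumes "prob_choice p lo hi"
  shows "est_variance A p lo hi y = (\<Sum>k=lo..hi. (1 / p k - 1) * (norm (A k y - A (k - 1) y))\<^sup>2)"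
proof -
  define d where "d k = A k y - A (k - 1) y" for k
  define \<xi> where "\<xi> B k = of_bool (B k) / p k - 1" for B k
  have mean: "est_mean A p lo hi y = (\<Sum>k=lo..hi. d k)"
    unfolding d_def by (rule est_mean_eq[OF assms])
  have "estimator A p lo hi B y - est_mean A p lo hi y = (\<Sum>k=lo..hi. \<xi> B k *\<^sub>R d k)" for B
    unfolding mean estimator_def d_def[symmetric] \<xi>_def
    by (simp add: sum_subtractf scaleR_diff_left)
  moreover have "(norm (\<Sum>k=lo..hi. \<xi> B k *\<^sub>R d k))\<^sup>2
      = (\<Sum>j=lo..hi. \<Sum>k=lo..hi. (\<xi> B j * \<xi> B k) * (d j \<bullet> d k))" for B
    unfolding power2_norm_eq_inner inner_sum_left inner_sum_right sum_distrib_left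
    by (intro sum.cong refl) (simp add: inner_commute)
  ultimately have "est_variance A p lo hi y = measure_pmf.expectation (switches p lo hi)
      (\<lambda>B. \<Sum>j=lo..hi. \<Sum>k=lo..hi. (\<xi> B j * \<xi> B k) * (d j \<bullet> d k))"
    unfolding est_variance_def by simp
  also have "\<dots> = (\<Sum>j=lo..hi. \<Sum>k=lo..hi.
      measure_pmf.expectation (switches p lo hi) (\<lambda>B. \<xi> B j * \<xi> B k) * (d j \<bullet> d k))"
    by (simp add: Bochner_Integration.integral_sum integrable_switches)
  also have "\<dots> = (\<Sum>j=lo..hi. \<Sum>k=lo..hi. (if j = k then 1 / p k - 1 else 0) * (d j \<bullet> d k))"
    unfolding \<xi>_def by (intro sum.cong refl arg_cong2[where f = "(*)"] covariance_switches[OF assms])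
  also have "\<dots> = (\<Sum>k=lo..hi. (1 / p k - 1) * (norm (d k))\<^sup>2)"
    by (simp add: if_distrib[of "\<lambda>x. x * _"] power2_norm_eq_inner cong: if_cong)
  finally show ?thesis by (simp add: d_def)
qed

lemma dyadic_hierarchy_error:
  assumes "dyadic_hierarchy \<gamma> c f A cost"
  shows "norm (A k y - f y) \<le> 2 powi (- k)"
proof -
  have "ereal (norm (A k y - f y)) \<le> sup_norm (\<lambda>y. A k y - f y)"
    unfolding sup_norm_def by (rule SUP_upper) simp
  also have "\<dots> \<le> ereal (2 powi (- k))"
    using assms by (simp add: dyadic_hierarchy_def)
  finally show ?thesis by simp
qed

text \<open>
  Both levels approximate \<open>f\<close>, and \<open>2\<^sup>-\<^sup>k + 2\<^sup>-\<^sup>(\<^sup>k\<^sup>-\<^sup>1\<^sup>) = 3 \<cdot> 2\<^sup>-\<^sup>k\<close>.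
\<close>
lemma dyadic_hierarchy_increment:
  assumes "dyadic_hierarchy \<gamma> c f A cost"
  shows "(norm (A k y - A (k - 1) y))\<^sup>2 \<le> 9 * 4 powi (- k)"
proof -
  have pred: "2 powi (- (k - 1)) = 2 * (2::real) powi (- k)"
    using power_int_add[of "2::real" "- k" 1] by (simp add: algebra_simps)
  have "norm (A k y - A (k - 1) y) \<le> norm (A k y - f y) + norm (A (k - 1) y - f y)"
    using norm_triangle_ineq4[of "A k y - f y" "A (k - 1) y - f y"] by simp
  also have "\<dots> \<le> 3 * 2 powi (- k)"
    using dyadic_hierarchy_error[OF assms, of k y] dyadic_hierarchy_error[OF assms, of "k - 1" y]
    unfolding pred by simp
  finally have "(norm (A k y - A (k - 1) y))\<^sup>2 \<le> (3 * 2 powi (- k))\<^sup>2"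
    by (intro power_mono) auto
  also have "\<dots> = 9 * ((2 powi (- k))\<^sup>2)" by (simp add: power_mult_distrib)
  also have "((2::real) powi (- k))\<^sup>2 = 4 powi (- k)"
    using power_int_mult_distrib[of "2::real" 2 "- k"] by (simp add: power2_eq_square)
  finally show ?thesis .
qed

section \<open>Expected compute\<close>

lemma sat_level_props:
  assumes "lo - 1 \<le> hi"
  shows "lo - 1 \<le> sat_level p lo hi" and "sat_level p lo hi \<le> hi"
    and "\<And>k. lo \<le> k \<Longrightarrow> k \<le> sat_level p lo hi \<Longrightarrow> p k = 1"
proof -
  let ?S = "{k \<in> {lo - 1..hi}. \<forall>j\<in>{lo..k}. p j = 1}"
  have fin: "finite ?S" by (rule finite_subset[of _ "{lo - 1..hi}"]) auto
  have mem: "lo - 1 \<in> ?S" using assms by auto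
  have "sat_level p lo hi \<in> ?S"
    unfolding sat_level_def by (rule Max_in[OF fin]) (use mem in blast)
  then show "sat_level p lo hi \<le> hi" and "\<And>k. lo \<le> k \<Longrightarrow> k \<le> sat_level p lo hi \<Longrightarrow> p k = 1"
    by auto
  show "lo - 1 \<le> sat_level p lo hi"
    unfolding sat_level_def by (rule Max_ge[OF fin mem])
qed

text \<open>
  Costs are bounded by a function increasing in the level, so the two evaluations behind an increment
  cost at most twice the bound of the upper one.
\<close>
lemma expected_compute_le_budget:
  assumes "dyadic_hierarchy \<gamma> c f A cost" and "\<gamma> > 0"
    and p: "prob_choice p lo hi" and "lo - 1 \<le> hi"
  shows "expected_compute cost p lo hi \<le> compute_budget \<gamma> c p lo hi"
proof -
  define s where "s = sat_level p lo hi"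
  have s: "lo - 1 \<le> s" "s \<le> hi"
    using sat_level_props[OF assms(4)] by (auto simp: s_def)
  have cost: "cost k \<le> c powr \<gamma> * 2 powr (\<gamma> * of_int k)" for k
    using assms(1) by (simp add: dyadic_hierarchy_def)
  have "expected_compute cost p lo hi = (if lo \<le> s then cost s else 0) +
      (\<Sum>k=s+1..hi. measure_pmf.expectation (switches p lo hi) (\<lambda>B. of_bool (B k)) * (cost k + cost (k - 1)))"
    unfolding expected_compute_def call_compute_def Let_def s_def[symmetric]
    by (simp add: Bochner_Integration.integral_sum integrable_switches del: sum_of_bool_mult_eq)
  also have "\<dots> = (if lo \<le> s then cost s else 0) + (\<Sum>k=s+1..hi. p k * (cost k + cost (k - 1)))"
    using s by (simp add: expectation_switch[OF p])
  also have "\<dots> \<le> compute_budget \<gamma> c p lo hi"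
    unfolding compute_budget_def Let_def s_def[symmetric]
  proof (intro add_mono sum_mono mult_left_mono)
    fix k assume k: "k \<in> {s + 1..hi}"
    have "cost (k - 1) \<le> c powr \<gamma> * 2 powr (\<gamma> * of_int (k - 1))" by (rule cost)
    also have "\<dots> \<le> c powr \<gamma> * 2 powr (\<gamma> * of_int k)"
      using \<open>\<gamma> > 0\<close> by (intro mult_left_mono powr_mono) auto
    finally show "cost k + cost (k - 1) \<le> 2 * c powr \<gamma> * 2 powr (\<gamma> * of_int k)"
      using cost[of k] by simp
    show "0 \<le> p k" using p k s by (auto simp: prob_choice_def less_imp_le)
  qed (use cost in auto)
  finally show ?thesis .
qed

section \<open>Geometric sums over levels\<close>

lemma powi_as_powr: "2 powi (- k) = 2 powr (- real_of_int k)" "4 powi (- k) = 2 powr (- 2 * real_of_int k)"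
proof -
  show "2 powi (- k) = 2 powr (- real_of_int k)"
    using powr_real_of_int'[of 2 "- k"] by simp
  have "4 powi (- k) = 4 powr (- real_of_int k)"
    using powr_real_of_int'[of 4 "- k"] by simp
  also have "(4::real) = 2 powr 2" by simp
  finally show "4 powi (- k) = 2 powr (- 2 * real_of_int k)" by (simp only: powr_powr) simp
qed

lemma geometric_sum_powr:
  fixes b :: real and m n :: int
  assumes "m - 1 \<le> n"
  shows "(1 - 2 powr (- b)) * (\<Sum>k=m..n. 2 powr (b * of_int k)) = 2 powr (b * of_int n) - 2 powr (b * of_int (m - 1))"
  using assms
proof (induction n rule: int_ge_induct)
  case (step i)
  have "{m..i + 1} = insert (i + 1) {m..i}" using step.hyps by auto
  moreover have "2 powr (- b) * 2 powr (b * of_int (i + 1)) = 2 powr (b * of_int i)"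
    by (simp add: algebra_simps flip: powr_add)
  ultimately show ?case using step.IH by (simp add: algebra_simps)
qed simp

lemma geometric_sum_increasing:
  fixes b :: real and m n :: int
  assumes "b > 0"
  shows "(\<Sum>k=m..n. 2 powr (b * of_int k)) \<le> 2 powr (b * of_int n) / (1 - 2 powr (- b))"
proof -
  have pos: "1 - 2 powr (- b) > (0::real)" using assms by (simp add: powr_less_one)
  show ?thesis
  proof (cases "m - 1 \<le> n")
    case True
    have "(1 - 2 powr (- b)) * (\<Sum>k=m..n. 2 powr (b * of_int k)) \<le> 2 powr (b * of_int n)"
      using geometric_sum_powr[OF True, of b] by simp
    then show ?thesis using pos by (simp add: field_simps)
  qed (use pos in auto)
qed

lemma geometric_sum_decreasing:
  fixes b :: real and m n :: int
  assumes "b < 0"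
  shows "(\<Sum>k=m..n. 2 powr (b * of_int k)) \<le> 2 powr (b * of_int m) / (1 - 2 powr b)"
proof -
  have "bij_betw uminus {- n..- m} {m..n}" by (intro bij_betwI[of _ _ _ uminus]) auto
  then have "(\<Sum>k=m..n. 2 powr (b * of_int k)) = (\<Sum>k=- n..- m. 2 powr ((- b) * of_int k))"
    by (subst sum.reindex_bij_betw[symmetric]) (auto simp: minus_mult_commute)
  also have "\<dots> \<le> 2 powr ((- b) * of_int (- m)) / (1 - 2 powr (- (- b)))"
    using assms by (intro geometric_sum_increasing) simp
  finally show ?thesis by simp
qed

section \<open>Optimality of the probabilities\<close>

text \<open>
  The compute budget without the telescoping discount: an increment is charged separately even when it
  is always drawn. Being linear in the probabilities, it can be minimised level by level.
\<close>
definition linear_budget :: "real \<Rightarrow> real \<Rightarrow> (int \<Rightarrow> real) \<Rightarrow> int \<Rightarrow> int \<Rightarrow> real" where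
  "linear_budget \<gamma> c q lo hi = (\<Sum>k=lo..hi. q k * (2 * c powr \<gamma> * 2 powr (\<gamma> * of_int k)))"

text \<open>
  With \<open>v\<^sub>k = 9 \<cdot> 4\<^sup>-\<^sup>k\<close> and \<open>w\<^sub>k = 2 c\<^sup>\<gamma> 2\<^sup>\<gamma>\<^sup>k\<close> for the variance and cost of level \<open>k\<close>, the geometric
  mean \<open>sqrt (v\<^sub>k w\<^sub>k)\<close> is a multiple of the summand below. Its growth rate \<open>\<gamma> / 2 - 1\<close> changes sign
  at \<open>\<gamma> = 2\<close>, which is where the three regimes come from.
\<close>
definition level_sum :: "real \<Rightarrow> int \<Rightarrow> int \<Rightarrow> real" where
  "level_sum \<gamma> m n = (\<Sum>k=m..n. 2 powr ((\<gamma> / 2 - 1) * of_int k))"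

text \<open>
  The two budgets differ on the saturated levels only. There one charges the last level and the other
  a sum of geometrically increasing costs, which the last level dominates since \<open>\<gamma> > 0\<close>.
\<close>
lemma compute_budget_le_linear_budget:
  assumes q: "prob_choice q lo hi" and "lo - 1 \<le> hi"
  shows "compute_budget \<gamma> c q lo hi \<le> linear_budget \<gamma> c q lo hi"
    and "\<gamma> > 0 \<Longrightarrow> linear_budget \<gamma> c q lo hi \<le> 2 / (1 - 2 powr (- \<gamma>)) * compute_budget \<gamma> c q lo hi"
proof -
  define s where "s = sat_level q lo hi"
  have s: "lo - 1 \<le> s" "s \<le> hi" "\<And>k. lo \<le> k \<Longrightarrow> k \<le> s \<Longrightarrow> q k = 1"
    using sat_level_props[OF assms(2)] by (auto simp: s_def)
  define w where "w k = 2 * c powr \<gamma> * 2 powr (\<gamma> * of_int k)" for k :: int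
  define H where "H = (if lo \<le> s then c powr \<gamma> * 2 powr (\<gamma> * of_int s) else 0)"
  define R where "R = (\<Sum>k=s+1..hi. q k * w k)"
  have w0: "0 \<le> w k" for k by (simp add: w_def)
  have R0: "0 \<le> R"
    unfolding R_def using q s w0 by (intro sum_nonneg mult_nonneg_nonneg) (auto simp: prob_choice_def less_imp_le)
  have budget: "compute_budget \<gamma> c q lo hi = H + R"
    by (simp add: compute_budget_def Let_def H_def R_def w_def flip: s_def)
  have "linear_budget \<gamma> c q lo hi = (\<Sum>k=lo..s. q k * w k) + R"
  proof -
    have "{lo..hi} = {lo..s} \<union> {s+1..hi}" using s by auto
    then show ?thesis unfolding linear_budget_def R_def w_def[symmetric]
      by (simp add: sum.union_disjoint)
  qed
  also have "(\<Sum>k=lo..s. q k * w k) = (\<Sum>k=lo..s. w k)" using s by (intro sum.cong) auto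
  finally have linear: "linear_budget \<gamma> c q lo hi = (\<Sum>k=lo..s. w k) + R" .
  \<comment> \<open>The single evaluation is one of the terms of the sum of all saturated increments.\<close>
  have "H \<le> (\<Sum>k=lo..s. w k)"
  proof (cases "lo \<le> s")
    case True
    have "H \<le> w s" using True by (simp add: H_def w_def)
    also have "\<dots> \<le> (\<Sum>k=lo..s. w k)" using True w0 by (intro member_le_sum) auto
    finally show ?thesis .
  qed (simp add: H_def)
  then show "compute_budget \<gamma> c q lo hi \<le> linear_budget \<gamma> c q lo hi"
    by (simp add: budget linear)
  assume "\<gamma> > 0"
  define G where "G = 2 / (1 - 2 powr (- \<gamma>))"
  have "0 < 1 - 2 powr (- \<gamma>)" "(0::real) < 2 powr (- \<gamma>)" using \<open>\<gamma> > 0\<close> by (simp_all add: powr_less_one)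
  then have "G \<ge> 1" by (simp add: G_def field_simps)
  have "(\<Sum>k=lo..s. w k) \<le> G * H"
  proof (cases "lo \<le> s")
    case True
    have "(\<Sum>k=lo..s. w k) = 2 * c powr \<gamma> * (\<Sum>k=lo..s. 2 powr (\<gamma> * of_int k))"
      by (simp add: w_def sum_distrib_left)
    also have "\<dots> \<le> 2 * c powr \<gamma> * (2 powr (\<gamma> * of_int s) / (1 - 2 powr (- \<gamma>)))"
      using geometric_sum_increasing[OF \<open>\<gamma> > 0\<close>] by (intro mult_left_mono) auto
    also have "\<dots> = G * H" using True by (simp add: G_def H_def)
    finally show ?thesis .
  qed (simp add: H_def)
  moreover have "R \<le> G * R" using R0 \<open>G \<ge> 1\<close> by (simp add: mult_le_cancel_right1)
  ultimately show "linear_budget \<gamma> c q lo hi \<le> 2 / (1 - 2 powr (- \<gamma>)) * compute_budget \<gamma> c q lo hi"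
    by (simp add: budget linear distrib_left flip: G_def)
qed

text \<open>
  The convex function \<open>q \<mapsto> q + t\<^sup>2 / q\<close> decreases up to its minimum at \<open>t\<close>, so on \<open>(0, 1]\<close> it is minimal
  at \<open>t\<close> or, if \<open>t\<close> lies beyond the interval, at \<open>1\<close>.
\<close>
lemma clipped_minimizes:
  fixes t q :: real
  assumes "t > 0" "0 < q" "q \<le> 1"
  shows "min t 1 + t\<^sup>2 / min t 1 \<le> q + t\<^sup>2 / q"
proof (cases "t \<le> 1")
  case True
  have "0 \<le> (q - t)\<^sup>2 / q" using assms by simp
  also have "\<dots> = q + t\<^sup>2 / q - 2 * t" using assms by (simp add: power2_eq_square field_simps)
  finally show ?thesis using True assms by (simp add: power2_eq_square)
next
  case False
  have "q \<le> t\<^sup>2" using False assms one_le_power[of t 2] by linarith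
  then have "0 \<le> (1 - q) * (t\<^sup>2 / q - 1)" using assms by (intro mult_nonneg_nonneg) (auto simp: field_simps)
  also have "\<dots> = q + t\<^sup>2 / q - (1 + t\<^sup>2)" using assms by (simp add: field_simps)
  finally show ?thesis using False by simp
qed

lemma level_prob_choice:
  assumes "C > 0"
  shows "prob_choice (level_prob \<gamma> C) lo hi"
  using assms by (simp add: prob_choice_def level_prob_def)

text \<open>
  Lagrange duality without differentiation: with the multiplier \<open>\<Lambda> = 2 c\<^sup>\<gamma> C\<^sup>2 / 9\<close>, the sum of the linear
  budget and \<open>\<Lambda>\<close> times the variance budget splits over the levels into copies of the function
  \<open>q + t\<^sup>2 / q\<close> with \<open>t = C 2\<^sup>-\<^sup>(\<^sup>1\<^sup>+\<^sup>\<gamma>\<^sup>/\<^sup>2\<^sup>)\<^sup>k\<close>. The probabilities of the theorem minimise each copy.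
\<close>
lemma level_prob_optimal:
  assumes "C > 0" and q: "prob_choice q lo hi"
    and var: "variance_budget q lo hi \<le> variance_budget (level_prob \<gamma> C) lo hi"
  shows "linear_budget \<gamma> c (level_prob \<gamma> C) lo hi \<le> linear_budget \<gamma> c q lo hi"
proof -
  define \<Lambda> where "\<Lambda> = 2 * c powr \<gamma> * C\<^sup>2 / 9"
  have "\<Lambda> \<ge> 0" by (simp add: \<Lambda>_def)
  define lagr where "lagr r = linear_budget \<gamma> c r lo hi + \<Lambda> * variance_budget r lo hi" for r
  have lagr_eq: "lagr r = (\<Sum>k=lo..hi. 2 * c powr \<gamma> * 2 powr (\<gamma> * of_int k) *
      (r k + (C * 2 powr (- (1 + \<gamma> / 2) * of_int k))\<^sup>2 / r k - (C * 2 powr (- (1 + \<gamma> / 2) * of_int k))\<^sup>2))"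
    for r
  proof -
    have e: "2 powr (- 2 * real_of_int k) = 2 powr (\<gamma> * of_int k) * (2 powr (- (1 + \<gamma> / 2) * of_int k))\<^sup>2" for k
      by (simp add: power2_eq_square algebra_simps flip: powr_add)
    show ?thesis
      unfolding lagr_def linear_budget_def variance_budget_def \<Lambda>_def sum_distrib_left sum.distrib[symmetric] powi_as_powr(2) e
      by (intro sum.cong refl) (simp add: field_simps)
  qed
  have "lagr (level_prob \<gamma> C) \<le> lagr q"
    unfolding lagr_eq
  proof (intro sum_mono mult_left_mono diff_right_mono)
    fix k assume "k \<in> {lo..hi}"
    then have "0 < q k" "q k \<le> 1" using q by (auto simp: prob_choice_def)
    then show "level_prob \<gamma> C k + (C * 2 powr (- (1 + \<gamma> / 2) * of_int k))\<^sup>2 / level_prob \<gamma> C k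
        \<le> q k + (C * 2 powr (- (1 + \<gamma> / 2) * of_int k))\<^sup>2 / q k"
      unfolding level_prob_def using \<open>C > 0\<close> by (intro clipped_minimizes) auto
  qed simp
  moreover have "\<Lambda> * variance_budget q lo hi \<le> \<Lambda> * variance_budget (level_prob \<gamma> C) lo hi"
    using var \<open>\<Lambda> \<ge> 0\<close> by (rule mult_left_mono)
  ultimately show ?thesis by (simp add: lagr_def)
qed

text \<open>
  The variance budget is continuous in \<open>C\<close>, vanishes once all levels are saturated and is unbounded as
  \<open>C\<close> tends to 0. Meeting the target exactly is what makes the choice optimal against every competitor
  that meets it with an inequality.
\<close>
lemma exists_exact_variance:
  assumes "\<gamma> > 0" "lo \<le> hi" "v > 0"
  shows "\<exists>C>0. variance_budget (level_prob \<gamma> C) lo hi = v"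
proof -
  define r where "r k = 2 powr (- (1 + \<gamma> / 2) * of_int k)" for k :: int
  have r: "r k > 0" for k by (simp add: r_def)
  \<comment> \<open>The value at which the contribution of the finest level alone is v.\<close>
  define C1 where "C1 = 1 / (r hi * (1 + v / (9 * 4 powi (- hi))))"
  \<comment> \<open>The finest level has the smallest probability, so it is the last one to saturate.\<close>
  define C2 where "C2 = 1 / r hi"
  have e0: "(0::real) < 9 * 4 powi (- hi)" by simp
  have f: "1 < 1 + v / (9 * 4 powi (- hi))" using assms(3) e0 by simp
  have C1: "C1 > 0" using f r[of hi] by (simp add: C1_def)
  have "C1 \<le> C2" unfolding C1_def C2_def using f r[of hi]
    by (intro divide_left_mono) (auto intro!: mult_pos_pos)
  have hi: "variance_budget (level_prob \<gamma> C2) lo hi = 0"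
    unfolding variance_budget_def
  proof (intro sum.neutral ballI)
    fix k assume "k \<in> {lo..hi}"
    then have "r hi \<le> r k" unfolding r_def using \<open>\<gamma> > 0\<close> by (intro powr_mono) auto
    then have "C2 * r k \<ge> 1" using r[of hi] by (simp add: C2_def field_simps)
    then have "level_prob \<gamma> C2 k = 1" by (simp add: level_prob_def r_def)
    then show "(1 / level_prob \<gamma> C2 k - 1) * (9 * 4 powi (- k)) = 0" by simp
  qed
  have lo: "v \<le> variance_budget (level_prob \<gamma> C1) lo hi"
  proof -
    have x: "C1 * r hi = 1 / (1 + v / (9 * 4 powi (- hi)))" using r[of hi] by (simp add: C1_def)
    also have "\<dots> \<le> 1" using f by simp
    finally have "level_prob \<gamma> C1 hi = 1 / (1 + v / (9 * 4 powi (- hi)))"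
      using x by (simp add: level_prob_def r_def)
    then have "v = (1 / level_prob \<gamma> C1 hi - 1) * (9 * 4 powi (- hi))" using e0 by simp
    also have "\<dots> \<le> variance_budget (level_prob \<gamma> C1) lo hi"
      unfolding variance_budget_def
      by (rule member_le_sum[of hi])
         (use assms level_prob_choice[OF C1, of \<gamma> lo hi] in \<open>auto simp: prob_choice_def\<close>)
    finally show ?thesis .
  qed
  have "continuous_on {C1..C2} (\<lambda>C. variance_budget (level_prob \<gamma> C) lo hi)"
    unfolding variance_budget_def level_prob_def r_def[symmetric]
    by (intro continuous_intros) (use C1 r in \<open>auto simp: min_def less_imp_neq[OF r, symmetric]\<close>)
  then obtain C where "C1 \<le> C" "variance_budget (level_prob \<gamma> C) lo hi = v"
    using IVT2'[of "\<lambda>C. variance_budget (level_prob \<gamma> C) lo hi" C2 v C1] hi lo assms(3) \<open>C1 \<le> C2\<close> by auto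
  with C1 show ?thesis by (intro exI[of _ C]) auto
qed

section \<open>Bounds on the optimal budget\<close>

text \<open>
  Cauchy--Schwarz on the levels from \<open>k\<close> on: the products \<open>(q\<^sub>j w\<^sub>j) (v\<^sub>j / q\<^sub>j)\<close> of cost and variance do
  not depend on \<open>q\<close>. Dropping the coarse levels keeps the term \<open>\<Sum> v\<^sub>j\<close>, by which \<open>\<Sum> v\<^sub>j / q\<^sub>j\<close>
  exceeds the variance budget, comparable to \<open>\<sigma>\<^sup>2\<close>.
\<close>
lemma linear_budget_lower_bound:
  assumes q: "prob_choice q lo hi" and var: "variance_budget q lo hi \<le> \<sigma>\<^sup>2" and "lo \<le> k"
  shows "18 * c powr \<gamma> * (level_sum \<gamma> k hi)\<^sup>2 \<le> linear_budget \<gamma> c q lo hi * (\<sigma>\<^sup>2 + 12 * 2 powr (- 2 * of_int k))"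
proof -
  define w where "w j = 2 * c powr \<gamma> * 2 powr (\<gamma> * of_int j)" for j :: int
  define v where "v j = 9 * 2 powr (- 2 * real_of_int j)" for j :: int
  have q0: "0 < q j" "q j \<le> 1" if "j \<in> {lo..hi}" for j using q that by (auto simp: prob_choice_def)
  have sub: "{k..hi} \<subseteq> {lo..hi}" using \<open>lo \<le> k\<close> by auto
  have nn: "0 \<le> w j" "0 \<le> v j" for j by (simp_all add: w_def v_def)
  have cost: "(\<Sum>j=k..hi. q j * w j) \<le> linear_budget \<gamma> c q lo hi"
    unfolding linear_budget_def w_def[symmetric]
    using q0 nn sub by (intro sum_mono2) (auto simp: less_imp_le)
  have "(\<Sum>j=k..hi. (1 / q j - 1) * v j) \<le> (\<Sum>j=lo..hi. (1 / q j - 1) * v j)"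
    using q0 nn sub by (intro sum_mono2) (auto intro!: mult_nonneg_nonneg)
  also have "\<dots> \<le> \<sigma>\<^sup>2" using var by (simp add: variance_budget_def v_def powi_as_powr)
  finally have "(\<Sum>j=k..hi. v j / q j) \<le> \<sigma>\<^sup>2 + (\<Sum>j=k..hi. v j)"
    by (simp add: algebra_simps sum_subtractf)
  also have "(\<Sum>j=k..hi. v j) \<le> 12 * 2 powr (- 2 * of_int k)"
  proof -
    \<comment> \<open>The constant 12 is 9 / (1 - 1/4).\<close>
    have e: "1 - 2 powr (-2) = (3 / 4 :: real)" by (simp add: powr_minus)
    have "(\<Sum>j=k..hi. 2 powr (- 2 * real_of_int j)) \<le> 2 powr (- 2 * of_int k) / (1 - 2 powr (-2))"
      by (rule geometric_sum_decreasing) simp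
    then show ?thesis unfolding v_def sum_distrib_left[symmetric] e by simp
  qed
  finally have var': "(\<Sum>j=k..hi. v j / q j) \<le> \<sigma>\<^sup>2 + 12 * 2 powr (- 2 * of_int k)" by simp
  have "18 * c powr \<gamma> * (level_sum \<gamma> k hi)\<^sup>2 = (\<Sum>j=k..hi. sqrt (q j * w j) * sqrt (v j / q j))\<^sup>2"
  proof -
    have "sqrt (q j * w j) * sqrt (v j / q j) = sqrt (18 * c powr \<gamma>) * 2 powr ((\<gamma> / 2 - 1) * of_int j)"
      if "j \<in> {k..hi}" for j
    proof -
      have "(2 powr ((\<gamma> / 2 - 1) * of_int j))\<^sup>2 = 2 powr (\<gamma> * of_int j) * 2 powr (- 2 * real_of_int j)"
        by (simp add: power2_eq_square algebra_simps flip: powr_add)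
      moreover have "q j \<noteq> 0" using q0[of j] that sub by auto
      ultimately have "q j * w j * (v j / q j) = 18 * c powr \<gamma> * (2 powr ((\<gamma> / 2 - 1) * of_int j))\<^sup>2"
        by (simp add: w_def v_def)
      then have "sqrt (q j * w j) * sqrt (v j / q j) = sqrt (18 * c powr \<gamma> * (2 powr ((\<gamma> / 2 - 1) * of_int j))\<^sup>2)"
        by (simp only: real_sqrt_mult[symmetric])
      then show ?thesis by (simp only: real_sqrt_mult real_sqrt_abs) simp
    qed
    then have "(\<Sum>j=k..hi. sqrt (q j * w j) * sqrt (v j / q j)) = sqrt (18 * c powr \<gamma>) * level_sum \<gamma> k hi"
      by (simp add: level_sum_def sum_distrib_left)
    then show ?thesis by (simp add: power_mult_distrib)
  qed
  also have "\<dots> \<le> (\<Sum>j=k..hi. (sqrt (q j * w j))\<^sup>2) * (\<Sum>j=k..hi. (sqrt (v j / q j))\<^sup>2)"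
    by (rule Cauchy_Schwarz_ineq_sum)
  also have "\<dots> = (\<Sum>j=k..hi. q j * w j) * (\<Sum>j=k..hi. v j / q j)"
    using q0 nn sub by (intro arg_cong2[where f = "(*)"] sum.cong refl) (auto simp: less_imp_le subset_eq)
  also have "\<dots> \<le> linear_budget \<gamma> c q lo hi * (\<sigma>\<^sup>2 + 12 * 2 powr (- 2 * of_int k))"
  proof (rule mult_mono[OF cost var'])
    show "0 \<le> linear_budget \<gamma> c q lo hi"
      unfolding linear_budget_def using q0 by (intro sum_nonneg) (auto simp: less_imp_le)
    show "0 \<le> (\<Sum>j=k..hi. v j / q j)" using q0 nn sub by (intro sum_nonneg) (auto simp: less_imp_le subset_eq)
  qed
  finally show ?thesis .
qed

text \<open>
  An explicit competitor: draw every increment up to \<open>K\<close>, and use probabilities of the prescribed form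
  above. On the levels above \<open>K\<close>, both the variance and the cost are bounded by multiples of the same
  geometric sum, and the factor \<open>C\<close> is the one for which the variance bound equals \<open>\<sigma>\<^sup>2\<close>.
\<close>
lemma truncated_sampling:
  assumes "\<gamma> > 0" "\<sigma> > 0" "lo - 1 \<le> K" "K \<le> hi"
  shows "\<exists>q. prob_choice q lo hi \<and> variance_budget q lo hi \<le> \<sigma>\<^sup>2 \<and>
     linear_budget \<gamma> c q lo hi \<le> 2 / (1 - 2 powr (- \<gamma>)) * c powr \<gamma> * (if lo \<le> K then 2 powr (\<gamma> * of_int K) else 0)
        + 18 * c powr \<gamma> * (level_sum \<gamma> (K + 1) hi)\<^sup>2 / \<sigma>\<^sup>2"
proof -
  define S where "S = level_sum \<gamma> (K + 1) hi"
  define C where "C = 9 * S / \<sigma>\<^sup>2"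
  \<comment> \<open>For K = hi there is no level above K, and the empty sum makes C equal to 0.\<close>
  have C: "C > 0" if "K < hi"
    using that \<open>\<sigma> > 0\<close> unfolding C_def S_def level_sum_def
    by (intro divide_pos_pos mult_pos_pos sum_pos) auto
  define q where "q k = (if k \<le> K then 1 else level_prob \<gamma> C k)" for k
  have split: "(\<Sum>k=lo..hi. g k) = (\<Sum>k=lo..K. g k) + (\<Sum>k=K+1..hi. g k)" for g :: "int \<Rightarrow> real"
  proof -
    have "{lo..hi} = {lo..K} \<union> {K+1..hi}" using assms by auto
    then show ?thesis by (simp add: sum.union_disjoint)
  qed
  have choice: "prob_choice q lo hi"
    using C by (auto simp: q_def prob_choice_def level_prob_def)
  have "variance_budget q lo hi \<le> \<sigma>\<^sup>2"
  proof (cases "K < hi")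
    case True
    have "variance_budget q lo hi = (\<Sum>k=K+1..hi. (1 / level_prob \<gamma> C k - 1) * (9 * 4 powi (- k)))"
      by (simp add: variance_budget_def split q_def)
    also have "\<dots> \<le> (\<Sum>k=K+1..hi. 9 / C * 2 powr ((\<gamma> / 2 - 1) * of_int k))"
    proof (rule sum_mono)
      fix k :: int
      define t where "t = C * 2 powr (- (1 + \<gamma> / 2) * of_int k)"
      have "t > 0" using C[OF True] by (simp add: t_def)
      then have "1 / level_prob \<gamma> C k - 1 \<le> 1 / t"
        unfolding level_prob_def t_def[symmetric] by (auto simp: min_def)
      then have "(1 / level_prob \<gamma> C k - 1) * (9 * 4 powi (- k)) \<le> 1 / t * (9 * 4 powi (- k))"
        by (rule mult_right_mono) simp
      also have "\<dots> = 9 / C * 2 powr ((\<gamma> / 2 - 1) * of_int k)"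
      proof -
        have "2 powr (- 2 * real_of_int k) / 2 powr (- (1 + \<gamma> / 2) * of_int k) = 2 powr ((\<gamma> / 2 - 1) * of_int k)"
          by (simp add: algebra_simps flip: powr_diff)
        then show ?thesis by (simp add: t_def powi_as_powr field_simps)
      qed
      finally show "(1 / level_prob \<gamma> C k - 1) * (9 * 4 powi (- k)) \<le> 9 / C * 2 powr ((\<gamma> / 2 - 1) * of_int k)" .
    qed
    also have "\<dots> = 9 / C * S" by (simp add: S_def level_sum_def sum_distrib_left)
    also have "\<dots> = \<sigma>\<^sup>2" using C[OF True] by (auto simp: C_def)
    finally show ?thesis .
  qed (simp add: variance_budget_def split q_def)
  moreover have "linear_budget \<gamma> c q lo hi
      \<le> 2 / (1 - 2 powr (- \<gamma>)) * c powr \<gamma> * (if lo \<le> K then 2 powr (\<gamma> * of_int K) else 0) + 18 * c powr \<gamma> * S\<^sup>2 / \<sigma>\<^sup>2"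
  proof -
    have "(\<Sum>k=lo..K. q k * (2 * c powr \<gamma> * 2 powr (\<gamma> * of_int k)))
        = 2 * c powr \<gamma> * (\<Sum>k=lo..K. 2 powr (\<gamma> * of_int k))"
      by (simp add: q_def sum_distrib_left)
    also have "\<dots> \<le> 2 * c powr \<gamma> * ((if lo \<le> K then 2 powr (\<gamma> * of_int K) else 0) / (1 - 2 powr (- \<gamma>)))"
      using geometric_sum_increasing[OF \<open>\<gamma> > 0\<close>] by (intro mult_left_mono) auto
    finally have sat: "(\<Sum>k=lo..K. q k * (2 * c powr \<gamma> * 2 powr (\<gamma> * of_int k)))
        \<le> 2 / (1 - 2 powr (- \<gamma>)) * c powr \<gamma> * (if lo \<le> K then 2 powr (\<gamma> * of_int K) else 0)" by simp
    have "(\<Sum>k=K+1..hi. q k * (2 * c powr \<gamma> * 2 powr (\<gamma> * of_int k)))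
       \<le> (\<Sum>k=K+1..hi. 2 * c powr \<gamma> * C * 2 powr ((\<gamma> / 2 - 1) * of_int k))"
    proof (rule sum_mono)
      fix k assume "k \<in> {K+1..hi}"
      then have "q k \<le> C * 2 powr (- (1 + \<gamma> / 2) * of_int k)" by (simp add: q_def level_prob_def)
      then have "q k * (2 * c powr \<gamma> * 2 powr (\<gamma> * of_int k))
         \<le> C * 2 powr (- (1 + \<gamma> / 2) * of_int k) * (2 * c powr \<gamma> * 2 powr (\<gamma> * of_int k))"
        by (rule mult_right_mono) simp
      also have "\<dots> = 2 * c powr \<gamma> * C * (2 powr (- (1 + \<gamma> / 2) * of_int k) * 2 powr (\<gamma> * of_int k))"
        by simp
      also have "2 powr (- (1 + \<gamma> / 2) * of_int k) * 2 powr (\<gamma> * of_int k) = 2 powr ((\<gamma> / 2 - 1) * of_int k)"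
        by (simp add: algebra_simps flip: powr_add)
      finally show "q k * (2 * c powr \<gamma> * 2 powr (\<gamma> * of_int k)) \<le> 2 * c powr \<gamma> * C * 2 powr ((\<gamma> / 2 - 1) * of_int k)" .
    qed
    also have "\<dots> = 2 * c powr \<gamma> * C * S" by (simp add: S_def level_sum_def sum_distrib_left)
    also have "\<dots> = 18 * c powr \<gamma> * S\<^sup>2 / \<sigma>\<^sup>2" by (simp add: C_def power2_eq_square)
    finally show ?thesis using sat by (simp add: linear_budget_def split)
  qed
  ultimately show ?thesis using choice unfolding S_def by blast
qed

section \<open>The three regimes\<close>

text \<open>
  In terms of \<open>\<tau> = - log\<^sub>2 \<sigma>\<close>, the level whose accuracy is \<open>\<sigma>\<close>, the three rates become the same power
  of \<open>c\<close> times an expression that is free of \<open>c\<close>.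
\<close>
lemma compute_rate_dyadic:
  assumes "c > 0" and "\<sigma> = 2 powr (- \<tau>)" and "\<delta> = 2 powr (- real_of_int h)"
  shows "compute_rate \<gamma> c \<delta> \<sigma> = c powr \<gamma> *
    (if \<gamma> > 2 then 2 powr (2 * \<tau> + (\<gamma> - 2) * of_int h)
     else if \<gamma> = 2 then 2 powr (2 * \<tau>) * (ln 2 * (of_int h - \<tau>))\<^sup>2
     else 2 powr (\<gamma> * \<tau>))"
proof -
  have sq: "\<sigma>\<^sup>2 = 2 powr (- (2 * \<tau>))" by (simp add: assms(2) power2_eq_square flip: powr_add)
  consider "\<gamma> > 2" | "\<gamma> = 2" | "\<gamma> < 2" by linarith
  then show ?thesis
  proof cases
    case 1
    have "\<delta> powr (2 - \<gamma>) / \<sigma>\<^sup>2 = 2 powr (2 * \<tau> + (\<gamma> - 2) * of_int h)"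
      unfolding sq assms(3) powr_powr powr_diff[symmetric] by (simp add: algebra_simps)
    then show ?thesis using 1 by (simp add: compute_rate_def flip: times_divide_eq_right)
  next
    case 2
    have "\<sigma> / \<delta> = 2 powr (of_int h - \<tau>)" unfolding assms(2,3) powr_diff[symmetric] by (simp add: algebra_simps)
    then have "ln (\<sigma> / \<delta>) = ln 2 * (of_int h - \<tau>)" by simp
    moreover have "1 / \<sigma>\<^sup>2 = 2 powr (2 * \<tau>)" unfolding sq by (simp add: powr_minus_divide)
    moreover have "c powr 2 = c\<^sup>2" using \<open>c > 0\<close> by simp
    ultimately show ?thesis using 2 by (simp add: compute_rate_def divide_inverse)
  next
    case 3
    have "(c / \<sigma>) powr \<gamma> = c powr \<gamma> * 2 powr (\<gamma> * \<tau>)"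
      using \<open>c > 0\<close> unfolding assms(2)
      by (simp add: powr_minus_divide powr_mult powr_powr mult.commute[of \<tau>])
    then show ?thesis using 3 by (simp add: compute_rate_def)
  qed
qed

lemma level_sum_nonneg: "0 \<le> level_sum \<gamma> m n"
  by (simp add: level_sum_def sum_nonneg)

text \<open>
  The competitor of \<open>truncated_sampling\<close> reaches the rate once \<open>K\<close> is suitable. For \<open>\<gamma> > 2\<close> the finest
  levels dominate the sum, and no level needs to be saturated. For \<open>\<gamma> \<le> 2\<close> one saturates the levels whose
  accuracy is coarser than \<open>\<sigma>\<close>; the remaining sum is then dominated by its first term if \<open>\<gamma> < 2\<close>, and
  has about \<open>log\<^sub>2 (\<sigma> / \<delta>)\<close> equal terms if \<open>\<gamma> = 2\<close>. In that last case the rate vanishes at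
  \<open>\<sigma> = \<delta>\<close>, whence the excluded interval, off which the logarithm is at least \<open>ln 2\<close> in absolute value.
\<close>
lemma achievable_rate:
  assumes "\<gamma> > 0"
  shows "\<exists>\<kappa>\<ge>0. \<forall>c lo hi \<sigma> \<delta>. c > 0 \<and> lo \<le> hi \<and> \<delta> = 2 powi (- hi) \<and> \<sigma> > 0 \<and>
      (\<gamma> = 2 \<longrightarrow> \<sigma> \<notin> {\<delta> / 2<..<2 * \<delta>}) \<longrightarrow>
    (\<exists>q. prob_choice q lo hi \<and> variance_budget q lo hi \<le> \<sigma>\<^sup>2 \<and>
         linear_budget \<gamma> c q lo hi \<le> \<kappa> * compute_rate \<gamma> c \<delta> \<sigma>)"
proof -
  define G where "G = 2 / (1 - 2 powr (- \<gamma>))"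
  have "0 < 1 - 2 powr (- \<gamma>)" using \<open>\<gamma> > 0\<close> by (simp add: powr_less_one)
  then have G0: "G \<ge> 0" by (simp add: G_def)
  define b where "b = \<gamma> / 2 - 1"
  define \<kappa> where "\<kappa> = (if \<gamma> > 2 then 18 / (1 - 2 powr (- b))\<^sup>2 else if \<gamma> = 2 then (G + 72) / (ln 2)\<^sup>2
      else G + 18 / (1 - 2 powr b)\<^sup>2)"
  have \<kappa>0: "\<kappa> \<ge> 0" using G0 by (simp add: \<kappa>_def)
  have "\<exists>q. prob_choice q lo hi \<and> variance_budget q lo hi \<le> \<sigma>\<^sup>2 \<and>
         linear_budget \<gamma> c q lo hi \<le> \<kappa> * compute_rate \<gamma> c \<delta> \<sigma>"
    if "c > 0" and lohi: "lo \<le> hi" and \<delta>: "\<delta> = 2 powi (- hi)" and "\<sigma> > 0"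
      and excl: "\<gamma> = 2 \<longrightarrow> \<sigma> \<notin> {\<delta> / 2<..<2 * \<delta>}" for c lo hi \<sigma> \<delta>
  proof -
    define \<tau> where "\<tau> = - log 2 \<sigma>"
    have \<sigma>\<tau>: "\<sigma> = 2 powr (- \<tau>)" using \<open>\<sigma> > 0\<close> by (simp add: \<tau>_def)
    have \<delta>h: "\<delta> = 2 powr (- real_of_int hi)" unfolding \<delta> by (rule powi_as_powr)
    note rate = compute_rate_dyadic[OF \<open>c > 0\<close> \<sigma>\<tau> \<delta>h, of \<gamma>]
    have inv_sq: "x / \<sigma>\<^sup>2 = x * 2 powr (2 * \<tau>)" for x
      by (simp add: \<sigma>\<tau> power2_eq_square powr_minus_divide flip: powr_add)
    \<comment> \<open>What remains is to choose the level K up to which every increment is drawn.\<close>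
    have reduce: ?thesis
      if K: "lo - 1 \<le> K" "K \<le> hi"
        and bound: "G * (if lo \<le> K then 2 powr (\<gamma> * of_int K) else 0) + 18 * (level_sum \<gamma> (K + 1) hi)\<^sup>2 * 2 powr (2 * \<tau>)
              \<le> \<kappa> * X" and X: "compute_rate \<gamma> c \<delta> \<sigma> = c powr \<gamma> * X" for K X
    proof -
      obtain q where q: "prob_choice q lo hi" "variance_budget q lo hi \<le> \<sigma>\<^sup>2"
        "linear_budget \<gamma> c q lo hi \<le> G * c powr \<gamma> * (if lo \<le> K then 2 powr (\<gamma> * of_int K) else 0)
          + 18 * c powr \<gamma> * (level_sum \<gamma> (K + 1) hi)\<^sup>2 / \<sigma>\<^sup>2"
        using truncated_sampling[OF \<open>\<gamma> > 0\<close> \<open>\<sigma> > 0\<close> K, of c] unfolding G_def by blast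
      note q(3)
      also have "G * c powr \<gamma> * (if lo \<le> K then 2 powr (\<gamma> * of_int K) else 0)
          + 18 * c powr \<gamma> * (level_sum \<gamma> (K + 1) hi)\<^sup>2 / \<sigma>\<^sup>2
        = c powr \<gamma> * (G * (if lo \<le> K then 2 powr (\<gamma> * of_int K) else 0)
          + 18 * (level_sum \<gamma> (K + 1) hi)\<^sup>2 * 2 powr (2 * \<tau>))"
        unfolding inv_sq by (simp add: algebra_simps)
      also have "\<dots> \<le> c powr \<gamma> * (\<kappa> * X)" using bound by (intro mult_left_mono) auto
      finally show ?thesis using q(1,2) X by (intro exI[of _ q]) (simp add: mult_ac)
    qed
    consider "\<gamma> > 2" | "\<gamma> = 2" | "\<gamma> < 2" by linarith
    then show ?thesis
    proof cases
      case 1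
      then have "b > 0" by (simp add: b_def)
      have S: "level_sum \<gamma> lo hi \<le> 2 powr (b * of_int hi) / (1 - 2 powr (- b))"
        unfolding level_sum_def b_def[symmetric] by (rule geometric_sum_increasing[OF \<open>b > 0\<close>])
      have "(level_sum \<gamma> lo hi)\<^sup>2 \<le> (2 powr (b * of_int hi) / (1 - 2 powr (- b)))\<^sup>2"
        by (rule power_mono[OF S level_sum_nonneg])
      then have "18 * (level_sum \<gamma> lo hi)\<^sup>2 * 2 powr (2 * \<tau>)
          \<le> 18 * (2 powr (b * of_int hi) / (1 - 2 powr (- b)))\<^sup>2 * 2 powr (2 * \<tau>)"
        by (intro mult_right_mono mult_left_mono) auto
      also have "\<dots> = \<kappa> * 2 powr (2 * \<tau> + (\<gamma> - 2) * of_int hi)"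
      proof -
        have "(2 powr (b * of_int hi))\<^sup>2 * 2 powr (2 * \<tau>) = 2 powr (2 * \<tau> + (\<gamma> - 2) * of_int hi)"
          by (simp add: power2_eq_square b_def algebra_simps flip: powr_add)
        then show ?thesis using 1 by (simp add: \<kappa>_def power_divide)
      qed
      finally show ?thesis using 1 lohi by (intro reduce[of "lo - 1", OF _ _ _ rate]) auto
    next
      case 2
      have k: "\<kappa> = (G + 72) / (ln 2)\<^sup>2" using 2 by (simp add: \<kappa>_def)
      have X: "\<kappa> * (2 powr (2 * \<tau>) * (ln 2 * (of_int hi - \<tau>))\<^sup>2) = (G + 72) * (of_int hi - \<tau>)\<^sup>2 * 2 powr (2 * \<tau>)"
        by (simp add: k power_mult_distrib)
      have "2 powr (- \<tau>) \<le> 2 powr (- real_of_int hi - 1) \<or> 2 powr (- real_of_int hi + 1) \<le> 2 powr (- \<tau>)"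
        using excl 2 by (auto simp: \<sigma>\<tau> \<delta>h powr_diff powr_add powr_minus_divide)
      then consider "\<tau> \<ge> of_int hi + 1" | "\<tau> \<le> of_int hi - 1"
        by auto
      then show ?thesis
      proof cases
        case 1
        have "G * (if lo \<le> hi then 2 powr (\<gamma> * of_int hi) else 0) + 18 * (level_sum \<gamma> (hi + 1) hi)\<^sup>2 * 2 powr (2 * \<tau>)
            = G * 2 powr (\<gamma> * of_int hi)"
          using lohi by (simp add: level_sum_def)
        also have "\<dots> \<le> G * 2 powr (2 * \<tau>)" using 1 2 G0 by (intro mult_left_mono) auto
        also have "\<dots> \<le> (G + 72) * 2 powr (2 * \<tau>)" by simp
        also have "\<dots> \<le> (G + 72) * (of_int hi - \<tau>)\<^sup>2 * 2 powr (2 * \<tau>)"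
        proof -
          have "1 \<le> (of_int hi - \<tau>)\<^sup>2" using 1 power_mono[of 1 "\<tau> - of_int hi" 2] by (simp add: power2_commute)
          then have "(G + 72) * 1 \<le> (G + 72) * (of_int hi - \<tau>)\<^sup>2" using G0 by (intro mult_left_mono) auto
          then show ?thesis by (intro mult_right_mono) auto
        qed
        finally show ?thesis unfolding X[symmetric] using 2 lohi by (intro reduce[of hi, OF _ _ _ rate]) auto
      next
        case upper: 2
        define K where "K = max (lo - 1) \<lfloor>\<tau>\<rfloor>"
        have K: "lo - 1 \<le> K" "K \<le> hi" "\<tau> < of_int K + 1" "lo \<le> K \<Longrightarrow> of_int K \<le> \<tau>"
          using upper lohi unfolding K_def by linarith+
        define m where "m = of_int hi - \<tau>"
        have m: "m \<ge> 1" using upper by (simp add: m_def)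
        have S: "level_sum \<gamma> (K + 1) hi = of_int (hi - K)" using 2 K by (simp add: level_sum_def)
        have "(level_sum \<gamma> (K + 1) hi)\<^sup>2 \<le> (2 * m)\<^sup>2"
          unfolding S using K m by (intro power_mono) (auto simp: m_def)
        then have "18 * (level_sum \<gamma> (K + 1) hi)\<^sup>2 * 2 powr (2 * \<tau>) \<le> 72 * m\<^sup>2 * 2 powr (2 * \<tau>)"
          by (intro mult_right_mono) (auto simp: power_mult_distrib)
        moreover have "G * (if lo \<le> K then 2 powr (\<gamma> * of_int K) else 0) \<le> G * m\<^sup>2 * 2 powr (2 * \<tau>)"
        proof -
          have "1 \<le> m\<^sup>2" using m power_mono[of 1 m 2] by simp
          have "(if lo \<le> K then 2 powr (\<gamma> * of_int K) else 0) \<le> 2 powr (2 * \<tau>)" using K 2 by auto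
          also have "\<dots> \<le> m\<^sup>2 * 2 powr (2 * \<tau>)" using \<open>1 \<le> m\<^sup>2\<close> by (simp add: mult_le_cancel_right1)
          finally show ?thesis using G0 by (simp only: mult.assoc mult_left_mono)
        qed
        ultimately have "G * (if lo \<le> K then 2 powr (\<gamma> * of_int K) else 0) + 18 * (level_sum \<gamma> (K + 1) hi)\<^sup>2 * 2 powr (2 * \<tau>)
            \<le> (G + 72) * m\<^sup>2 * 2 powr (2 * \<tau>)"
          by (simp only: distrib_right)
        then show ?thesis unfolding m_def X[symmetric] using 2 K by (intro reduce[of K, OF _ _ _ rate]) auto
      qed
    next
      case 3
      then have "b < 0" by (simp add: b_def)
      define K where "K = max (lo - 1) (min hi \<lfloor>\<tau>\<rfloor>)"
      have K: "lo - 1 \<le> K" "K \<le> hi" "K < hi \<Longrightarrow> \<tau> \<le> of_int K + 1" "lo \<le> K \<Longrightarrow> of_int K \<le> \<tau>"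
        using lohi unfolding K_def by linarith+
      have "G * (if lo \<le> K then 2 powr (\<gamma> * of_int K) else 0) \<le> G * 2 powr (\<gamma> * \<tau>)"
        using K G0 \<open>\<gamma> > 0\<close> by (intro mult_left_mono) auto
      moreover have "18 * (level_sum \<gamma> (K + 1) hi)\<^sup>2 * 2 powr (2 * \<tau>) \<le> 18 / (1 - 2 powr b)\<^sup>2 * 2 powr (\<gamma> * \<tau>)"
      proof (cases "K < hi")
        case True
        have pos: "1 - 2 powr b > 0" using \<open>b < 0\<close> by (simp add: powr_less_one)
        have "level_sum \<gamma> (K + 1) hi \<le> 2 powr (b * of_int (K + 1)) / (1 - 2 powr b)"
          unfolding level_sum_def b_def[symmetric] by (rule geometric_sum_decreasing[OF \<open>b < 0\<close>])
        also have "\<dots> \<le> 2 powr (b * \<tau>) / (1 - 2 powr b)"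
          using K(3)[OF True] \<open>b < 0\<close> pos by (intro divide_right_mono) auto
        finally have "(level_sum \<gamma> (K + 1) hi)\<^sup>2 \<le> (2 powr (b * \<tau>) / (1 - 2 powr b))\<^sup>2"
          using level_sum_nonneg by (rule power_mono)
        then have "18 * (level_sum \<gamma> (K + 1) hi)\<^sup>2 * 2 powr (2 * \<tau>)
            \<le> 18 * (2 powr (b * \<tau>) / (1 - 2 powr b))\<^sup>2 * 2 powr (2 * \<tau>)"
          by (intro mult_right_mono mult_left_mono) auto
        also have "\<dots> = 18 / (1 - 2 powr b)\<^sup>2 * 2 powr (\<gamma> * \<tau>)"
        proof -
          have "(2 powr (b * \<tau>))\<^sup>2 * 2 powr (2 * \<tau>) = 2 powr (\<gamma> * \<tau>)"
            by (simp add: power2_eq_square b_def algebra_simps flip: powr_add)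
          then show ?thesis by (simp add: power_divide)
        qed
        finally show ?thesis .
      qed (simp add: level_sum_def)
      ultimately show ?thesis using 3 K
        by (intro reduce[of K, OF _ _ _ rate]) (auto simp: \<kappa>_def distrib_right)
    qed
  qed
  with \<kappa>0 show ?thesis by blast
qed

text \<open>
  The lower bound of \<open>linear_budget_lower_bound\<close> is sharp for a suitable first level: the finest one
  if \<open>\<gamma> > 2\<close>, and otherwise the level of accuracy about \<open>\<sigma>\<close>, which exists because \<open>\<sigma>\<close> lies between
  \<open>\<delta>\<close> and the accuracy of level \<open>lo - 1\<close>.
\<close>
lemma necessary_rate:
  assumes "\<gamma> > 0" "c > 0" "lo \<le> hi" and \<delta>: "\<delta> = 2 powi (- hi)" and "\<sigma> > 0" "\<delta> \<le> \<sigma>"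
    and large: "\<gamma> \<le> 2 \<Longrightarrow> of_int lo - 1 \<le> - log 2 \<sigma>"
    and q: "prob_choice q lo hi" "variance_budget q lo hi \<le> \<sigma>\<^sup>2"
  shows "compute_rate \<gamma> c \<delta> \<sigma> \<le> 11 * linear_budget \<gamma> c q lo hi"
proof -
  define \<tau> where "\<tau> = - log 2 \<sigma>"
  have \<sigma>\<tau>: "\<sigma> = 2 powr (- \<tau>)" using \<open>\<sigma> > 0\<close> by (simp add: \<tau>_def)
  have \<delta>h: "\<delta> = 2 powr (- real_of_int hi)" unfolding \<delta> by (rule powi_as_powr)
  have \<tau>h: "\<tau> \<le> of_int hi" using \<open>\<delta> \<le> \<sigma>\<close> by (simp add: \<sigma>\<tau> \<delta>h)
  have sq: "\<sigma>\<^sup>2 = 2 powr (- 2 * \<tau>)" by (simp add: \<sigma>\<tau> power2_eq_square flip: powr_add)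
  define D where "D = linear_budget \<gamma> c q lo hi"
  have D0: "D \<ge> 0" unfolding D_def linear_budget_def using q(1)
    by (intro sum_nonneg) (auto simp: prob_choice_def less_imp_le)
  note rate = compute_rate_dyadic[OF \<open>c > 0\<close> \<sigma>\<tau> \<delta>h, of \<gamma>]
  have bound: "18 * (c powr \<gamma> * ((level_sum \<gamma> k hi)\<^sup>2 * 2 powr (2 * \<tau>))) \<le> M * D"
    if "lo \<le> k" "1 + 12 * 2 powr (2 * (\<tau> - of_int k)) \<le> M" for k M
  proof -
    have "18 * c powr \<gamma> * (level_sum \<gamma> k hi)\<^sup>2 * 2 powr (2 * \<tau>)
        \<le> D * (\<sigma>\<^sup>2 + 12 * 2 powr (- 2 * of_int k)) * 2 powr (2 * \<tau>)"
      unfolding D_def using linear_budget_lower_bound[OF q that(1)] by (intro mult_right_mono) auto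
    also have "\<dots> = D * (1 + 12 * 2 powr (2 * (\<tau> - of_int k)))"
      unfolding sq by (simp add: algebra_simps flip: powr_add)
    also have "\<dots> \<le> D * M" using that(2) D0 by (rule mult_left_mono)
    finally show ?thesis by (simp add: mult_ac)
  qed
  show ?thesis
  proof (cases "\<gamma> > 2")
    case True
    have "2 powr (2 * (\<tau> - of_int hi)) \<le> 2 powr 0" using \<tau>h by (intro powr_mono) auto
    then have "18 * (c powr \<gamma> * ((level_sum \<gamma> hi hi)\<^sup>2 * 2 powr (2 * \<tau>))) \<le> 13 * D"
      using \<open>lo \<le> hi\<close> by (intro bound) auto
    moreover have "(level_sum \<gamma> hi hi)\<^sup>2 * 2 powr (2 * \<tau>) = 2 powr (2 * \<tau> + (\<gamma> - 2) * of_int hi)"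
      by (simp add: level_sum_def power2_eq_square algebra_simps flip: powr_add)
    ultimately have "18 * compute_rate \<gamma> c \<delta> \<sigma> \<le> 13 * D" using True rate by simp
    then show ?thesis using D0 unfolding D_def by linarith
  next
    case False
    define k where "k = max lo \<lfloor>\<tau>\<rfloor>"
    have k: "lo \<le> k" "k \<le> hi" "\<tau> - 1 \<le> of_int k" "of_int k \<le> \<tau> + 1"
      using False large \<tau>h \<open>lo \<le> hi\<close> unfolding k_def \<tau>_def[symmetric] by linarith+
    \<comment> \<open>Level k is at most one level coarser than the accuracy sigma, so the factor is at most 1 + 12 * 4 = 49.\<close>
    have "2 powr (2 * (\<tau> - of_int k)) \<le> 2 powr 2" using k by (intro powr_mono) auto
    then have low: "18 * (c powr \<gamma> * ((level_sum \<gamma> k hi)\<^sup>2 * 2 powr (2 * \<tau>))) \<le> 49 * D"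
      using k by (intro bound) auto
    show ?thesis
    proof (cases "\<gamma> = 2")
      case True
      have S: "level_sum \<gamma> k hi = of_int (hi - k + 1)" using True k by (simp add: level_sum_def)
      have "(ln 2 * (of_int hi - \<tau>))\<^sup>2 \<le> (level_sum \<gamma> k hi)\<^sup>2"
      proof (rule power_mono)
        have "ln 2 * (of_int hi - \<tau>) \<le> 1 * (of_int hi - \<tau>)"
          using \<tau>h ln_le_minus_one[of 2] by (intro mult_right_mono) auto
        then show "ln 2 * (of_int hi - \<tau>) \<le> level_sum \<gamma> k hi" using S k by simp
      qed (use \<tau>h in auto)
      then have "c powr \<gamma> * (2 powr (2 * \<tau>) * (ln 2 * (of_int hi - \<tau>))\<^sup>2)
          \<le> c powr \<gamma> * (2 powr (2 * \<tau>) * (level_sum \<gamma> k hi)\<^sup>2)"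
        by (intro mult_left_mono) auto
      then have "18 * compute_rate \<gamma> c \<delta> \<sigma> \<le> 49 * D" using True rate low by (simp add: mult_ac)
      then show ?thesis using D0 unfolding D_def by linarith
    next
      case neq: False
      have "2 powr ((\<gamma> / 2 - 1) * (\<tau> + 1)) \<le> 2 powr ((\<gamma> / 2 - 1) * of_int k)"
        using False k by (intro powr_mono) (auto intro!: mult_left_mono_neg)
      also have "\<dots> \<le> level_sum \<gamma> k hi" unfolding level_sum_def using k by (intro member_le_sum) auto
      finally have "(2 powr ((\<gamma> / 2 - 1) * (\<tau> + 1)))\<^sup>2 \<le> (level_sum \<gamma> k hi)\<^sup>2" by (intro power_mono) auto
      then have "(2 powr ((\<gamma> / 2 - 1) * (\<tau> + 1)))\<^sup>2 * 2 powr (2 * \<tau>) \<le> (level_sum \<gamma> k hi)\<^sup>2 * 2 powr (2 * \<tau>)"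
        by (intro mult_right_mono) auto
      moreover have "(2 powr ((\<gamma> / 2 - 1) * (\<tau> + 1)))\<^sup>2 * 2 powr (2 * \<tau>) = 2 powr (\<gamma> - 2) * 2 powr (\<gamma> * \<tau>)"
        by (simp add: power2_eq_square algebra_simps flip: powr_add)
      moreover have "2 powr (\<gamma> * \<tau>) \<le> 4 * (2 powr (\<gamma> - 2) * 2 powr (\<gamma> * \<tau>))"
      proof -
        have "2 powr (- 2) \<le> 2 powr (\<gamma> - 2)" using \<open>\<gamma> > 0\<close> by (intro powr_mono) auto
        then show ?thesis by (simp add: powr_minus)
      qed
      ultimately have "2 powr (\<gamma> * \<tau>) \<le> 4 * ((level_sum \<gamma> k hi)\<^sup>2 * 2 powr (2 * \<tau>))" by linarith
      then have "c powr \<gamma> * 2 powr (\<gamma> * \<tau>) \<le> c powr \<gamma> * (4 * ((level_sum \<gamma> k hi)\<^sup>2 * 2 powr (2 * \<tau>)))"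
        by (intro mult_left_mono) auto
      then have "18 * compute_rate \<gamma> c \<delta> \<sigma> \<le> 196 * D" using False neq rate low by simp
      then show ?thesis using D0 unfolding D_def by linarith
    qed
  qed
qed

section \<open>Bias, variance and optimal compute\<close>

theorem proposition3:
  fixes \<gamma> :: real
  assumes "\<gamma> > 0"
  shows
    "(\<forall>(L :: real ^ 'n \<Rightarrow> real) f \<beta> A cost c k_max p.
        convex_on UNIV L \<and> (\<forall>x. GDERIV L x :> f x) \<and> \<beta>-lipschitz_on UNIV f \<and>
        c > 0 \<and> dyadic_hierarchy \<gamma> c f A cost \<and> A (k_min c - 1) = (\<lambda>y. 0) \<and>
        k_min c \<le> k_max \<and> prob_choice p (k_min c) k_max \<longrightarrow>
          (\<forall>y. est_bias f A p (k_min c) k_max y \<le> 2 powi (- k_max)) \<and>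
          (\<forall>y. est_variance A p (k_min c) k_max y \<le> variance_budget p (k_min c) k_max) \<and>
          expected_compute cost p (k_min c) k_max \<le> compute_budget \<gamma> c p (k_min c) k_max)
     \<and>
     (\<exists>\<kappa>\<ge>1. \<forall>c k_max \<delta> \<sigma>.
        c > 0 \<and> k_min c \<le> k_max \<and> \<delta> = 2 powi (- k_max) \<and> \<sigma> > 0 \<longrightarrow>
        (\<exists>C>0.
          let p = level_prob \<gamma> C; E = compute_budget \<gamma> c p (k_min c) k_max in
          variance_budget p (k_min c) k_max \<le> \<sigma>\<^sup>2 \<and>
          ((\<gamma> = 2 \<longrightarrow> \<sigma> \<notin> {\<delta> / 2<..<2 * \<delta>}) \<longrightarrow> E \<le> \<kappa> * compute_rate \<gamma> c \<delta> \<sigma>) \<and>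
          (\<delta> \<le> \<sigma> \<and> (\<gamma> \<le> 2 \<longrightarrow> \<sigma> \<le> c) \<longrightarrow> compute_rate \<gamma> c \<delta> \<sigma> \<le> \<kappa> * E) \<and>
          (\<forall>q. prob_choice q (k_min c) k_max \<and> variance_budget q (k_min c) k_max \<le> \<sigma>\<^sup>2 \<longrightarrow>
               E \<le> \<kappa> * compute_budget \<gamma> c q (k_min c) k_max)))"
proof (intro conjI)
  show "\<forall>(L :: real ^ 'n \<Rightarrow> real) f \<beta> A cost c k_max p.
        convex_on UNIV L \<and> (\<forall>x. GDERIV L x :> f x) \<and> \<beta>-lipschitz_on UNIV f \<and>
        c > 0 \<and> dyadic_hierarchy \<gamma> c f A cost \<and> A (k_min c - 1) = (\<lambda>y. 0) \<and>
        k_min c \<le> k_max \<and> prob_choice p (k_min c) k_max \<longrightarrow>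
          (\<forall>y. est_bias f A p (k_min c) k_max y \<le> 2 powi (- k_max)) \<and>
          (\<forall>y. est_variance A p (k_min c) k_max y \<le> variance_budget p (k_min c) k_max) \<and>
          expected_compute cost p (k_min c) k_max \<le> compute_budget \<gamma> c p (k_min c) k_max"
  proof (intro allI impI, elim conjE, intro conjI allI)
    fix f :: "real ^ 'n \<Rightarrow> real ^ 'n" and A cost c k_max p y
    assume h: "dyadic_hierarchy \<gamma> c f A cost" and zero: "A (k_min c - 1) = (\<lambda>y. 0)"
      and levels: "k_min c \<le> k_max" and p: "prob_choice p (k_min c) k_max"
    have "est_mean A p (k_min c) k_max y = A k_max y"
      using est_mean_telescope[OF p, of A y] levels zero by simp
    then show "est_bias f A p (k_min c) k_max y \<le> 2 powi (- k_max)"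
      using dyadic_hierarchy_error[OF h] by (simp add: est_bias_def)
    show "est_variance A p (k_min c) k_max y \<le> variance_budget p (k_min c) k_max"
      unfolding est_variance_eq[OF p] variance_budget_def
      using p dyadic_hierarchy_increment[OF h]
      by (intro sum_mono mult_left_mono) (auto simp: prob_choice_def)
    show "expected_compute cost p (k_min c) k_max \<le> compute_budget \<gamma> c p (k_min c) k_max"
      using expected_compute_le_budget[OF h assms p] levels by simp
  qed
next
  define G where "G = 2 / (1 - 2 powr (- \<gamma>))"
  have "0 < 1 - 2 powr (- \<gamma>)" "(0::real) < 2 powr (- \<gamma>)" using assms by (simp_all add: powr_less_one)
  then have G: "G \<ge> 1" by (simp add: G_def field_simps)
  obtain \<kappa>\<^sub>1 where "\<kappa>\<^sub>1 \<ge> 0" and achievable: "\<And>c lo hi \<sigma> \<delta>. c > 0 \<and> lo \<le> hi \<and> \<delta> = 2 powi (- hi) \<and> \<sigma> > 0 \<and>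
      (\<gamma> = 2 \<longrightarrow> \<sigma> \<notin> {\<delta> / 2<..<2 * \<delta>}) \<Longrightarrow>
    \<exists>q. prob_choice q lo hi \<and> variance_budget q lo hi \<le> \<sigma>\<^sup>2 \<and>
         linear_budget \<gamma> c q lo hi \<le> \<kappa>\<^sub>1 * compute_rate \<gamma> c \<delta> \<sigma>"
    using achievable_rate[OF assms] by meson
  define \<kappa> where "\<kappa> = 11 * G + \<kappa>\<^sub>1"
  have \<kappa>: "1 \<le> \<kappa>" "\<kappa>\<^sub>1 \<le> \<kappa>" "G \<le> \<kappa>" "11 * G \<le> \<kappa>" using G \<open>\<kappa>\<^sub>1 \<ge> 0\<close> by (simp_all add: \<kappa>_def)
  show "\<exists>\<kappa>\<ge>1. \<forall>c k_max \<delta> \<sigma>.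
        c > 0 \<and> k_min c \<le> k_max \<and> \<delta> = 2 powi (- k_max) \<and> \<sigma> > 0 \<longrightarrow>
        (\<exists>C>0.
          let p = level_prob \<gamma> C; E = compute_budget \<gamma> c p (k_min c) k_max in
          variance_budget p (k_min c) k_max \<le> \<sigma>\<^sup>2 \<and>
          ((\<gamma> = 2 \<longrightarrow> \<sigma> \<notin> {\<delta> / 2<..<2 * \<delta>}) \<longrightarrow> E \<le> \<kappa> * compute_rate \<gamma> c \<delta> \<sigma>) \<and>
          (\<delta> \<le> \<sigma> \<and> (\<gamma> \<le> 2 \<longrightarrow> \<sigma> \<le> c) \<longrightarrow> compute_rate \<gamma> c \<delta> \<sigma> \<le> \<kappa> * E) \<and>
          (\<forall>q. prob_choice q (k_min c) k_max \<and> variance_budget q (k_min c) k_max \<le> \<sigma>\<^sup>2 \<longrightarrow>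
               E \<le> \<kappa> * compute_budget \<gamma> c q (k_min c) k_max))"
  proof (rule exI[of _ \<kappa>], rule conjI[OF \<kappa>(1)], intro allI impI, elim conjE)
    fix c \<delta> \<sigma> :: real and hi
    define lo where "lo = k_min c"
    assume "c > 0" and "k_min c \<le> hi" and \<delta>: "\<delta> = 2 powi (- hi)" and "\<sigma> > 0"
    then have lohi: "lo \<le> hi" by (simp add: lo_def)
    \<comment> \<open>One C serves the rate, its converse and the optimality alike.\<close>
    obtain C where "C > 0" and var: "variance_budget (level_prob \<gamma> C) lo hi = \<sigma>\<^sup>2"
      using exists_exact_variance[OF assms lohi, of "\<sigma>\<^sup>2"] \<open>\<sigma> > 0\<close> by auto
    define p where "p = level_prob \<gamma> C"
    have p: "prob_choice p lo hi" unfolding p_def by (rule level_prob_choice[OF \<open>C > 0\<close>])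
    have le_linear: "compute_budget \<gamma> c q lo hi \<le> linear_budget \<gamma> c q lo hi" 
      and linear_le: "linear_budget \<gamma> c q lo hi \<le> G * compute_budget \<gamma> c q lo hi" 
      and budget_nonneg: "0 \<le> compute_budget \<gamma> c q lo hi" if "prob_choice q lo hi" for q
    proof -
      show "compute_budget \<gamma> c q lo hi \<le> linear_budget \<gamma> c q lo hi" and
        linear: "linear_budget \<gamma> c q lo hi \<le> G * compute_budget \<gamma> c q lo hi"
        using compute_budget_le_linear_budget[OF that, of \<gamma> c] assms lohi by (simp_all add: G_def)
      have "0 \<le> linear_budget \<gamma> c q lo hi"
        unfolding linear_budget_def using that by (intro sum_nonneg) (auto simp: prob_choice_def less_imp_le)
      with linear G show "0 \<le> compute_budget \<gamma> c q lo hi" by (smt (verit) zero_le_mult_iff)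
    qed
    define E where "E = compute_budget \<gamma> c p lo hi"
    have optimal: "E \<le> linear_budget \<gamma> c q lo hi" if "prob_choice q lo hi" "variance_budget q lo hi \<le> \<sigma>\<^sup>2" for q
      using le_linear[OF p] level_prob_optimal[OF \<open>C > 0\<close> that(1), of \<gamma> c] that(2) var
      unfolding E_def p_def by simp
    have rate_nonneg: "0 \<le> compute_rate \<gamma> c \<delta> \<sigma>" by (simp add: compute_rate_def)
    have upper: "E \<le> \<kappa> * compute_rate \<gamma> c \<delta> \<sigma>" if "\<gamma> = 2 \<longrightarrow> \<sigma> \<notin> {\<delta> / 2<..<2 * \<delta>}"
    proof -
      have "E \<le> \<kappa>\<^sub>1 * compute_rate \<gamma> c \<delta> \<sigma>"
        using achievable[of c lo hi \<delta> \<sigma>] that \<open>c > 0\<close> lohi \<delta> \<open>\<sigma> > 0\<close> optimal order_trans by blast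
      also have "\<dots> \<le> \<kappa> * compute_rate \<gamma> c \<delta> \<sigma>" by (intro mult_right_mono \<kappa> rate_nonneg)
      finally show ?thesis .
    qed
    have lower: "compute_rate \<gamma> c \<delta> \<sigma> \<le> \<kappa> * E" if "\<delta> \<le> \<sigma>" "\<gamma> \<le> 2 \<longrightarrow> \<sigma> \<le> c"
    proof -
      have "of_int lo - 1 \<le> - log 2 \<sigma>" if "\<gamma> \<le> 2"
      proof -
        have "of_int lo - 1 \<le> - log 2 c" by (simp add: lo_def k_min_def)
        also have "\<dots> \<le> - log 2 \<sigma>" using that \<open>\<gamma> \<le> 2 \<longrightarrow> \<sigma> \<le> c\<close> \<open>\<sigma> > 0\<close> by simp
        finally show ?thesis .
      qed
      then have "compute_rate \<gamma> c \<delta> \<sigma> \<le> 11 * linear_budget \<gamma> c p lo hi"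
        using necessary_rate[OF assms \<open>c > 0\<close> lohi \<delta> \<open>\<sigma> > 0\<close> \<open>\<delta> \<le> \<sigma>\<close> _ p] var by (simp add: p_def)
      also have "\<dots> \<le> (11 * G) * E" using linear_le[OF p] by (simp add: E_def)
      also have "\<dots> \<le> \<kappa> * E" using budget_nonneg[OF p] by (intro mult_right_mono \<kappa>) (simp add: E_def)
      finally show ?thesis .
    qed
    have order_optimal: "E \<le> \<kappa> * compute_budget \<gamma> c q lo hi"
      if "prob_choice q lo hi" "variance_budget q lo hi \<le> \<sigma>\<^sup>2" for q
    proof -
      have "E \<le> G * compute_budget \<gamma> c q lo hi" using optimal[OF that] linear_le[OF that(1)] by simp
      also have "\<dots> \<le> \<kappa> * compute_budget \<gamma> c q lo hi" by (intro mult_right_mono \<kappa> budget_nonneg that)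
      finally show ?thesis .
    qed
    show "\<exists>C>0.
          let p = level_prob \<gamma> C; E = compute_budget \<gamma> c p (k_min c) hi in
          variance_budget p (k_min c) hi \<le> \<sigma>\<^sup>2 \<and>
          ((\<gamma> = 2 \<longrightarrow> \<sigma> \<notin> {\<delta> / 2<..<2 * \<delta>}) \<longrightarrow> E \<le> \<kappa> * compute_rate \<gamma> c \<delta> \<sigma>) \<and>
          (\<delta> \<le> \<sigma> \<and> (\<gamma> \<le> 2 \<longrightarrow> \<sigma> \<le> c) \<longrightarrow> compute_rate \<gamma> c \<delta> \<sigma> \<le> \<kappa> * E) \<and>
          (\<forall>q. prob_choice q (k_min c) hi \<and> variance_budget q (k_min c) hi \<le> \<sigma>\<^sup>2 \<longrightarrow>
               E \<le> \<kappa> * compute_budget \<gamma> c q (k_min c) hi)"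
      unfolding lo_def[symmetric] Let_def
      using \<open>C > 0\<close> var upper lower order_optimal unfolding E_def p_def
      by (intro exI[of _ C]) auto
  qed
qed

end
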